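(* Let $S$ be a semigroup, let $\sigma: S\to S$ be an involutive automorphism and let $\tau: S\to S$ be an involutive anti-automorphism. Let $f: S\to\mathbb{C}$ be a non-zero solution of the functional equation $$f(x\sigma(y))+f(\tau(y)x)=2f(x)f(y)\quad\text{for all }x,y\in S.$$ Then: (1) $f$ is central, i.e. $f(xy)=f(yx)$ for all $x,y\in S$. (2) There is some $\lambda\in\mathbb{C}\setminus\{0\}$ such that $f(\sigma(x))+f(\tau(x))=\lambda f(x)$ for all $x\in S$. (3) $f$ is a solution of the pre-d'Alembert functional equation, i.e. $$f(axy)+f(ayx)=2f(a)f(xy)+2f(x)f(ay)+2f(ax)f(y)-4f(a)f(x)f(y)$$ for all $a,x,y\in S$.
   Context: $\sigma$ being an involutive automorphism means $\sigma(xy)=\sigma(x)\sigma(y)$ and $\sigma(\sigma(x))=x$ for all $x,y\in S$; $\tau$ being an involutive anti-automorphism means $\tau(xy)=\tau(y)\tau(x)$ and $\tau(\tau(x))=x$ for all $x,y\in S$. Non-zero means not identically zero. *)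

theory Defs
  imports Complex_Main
begin

definition involutive_automorphism :: "('a::semigroup_mult \<Rightarrow> 'a) \<Rightarrow> bool" where
  "involutive_automorphism \<sigma> \<longleftrightarrow>
     (\<forall>x y. \<sigma> (x * y) = \<sigma> x * \<sigma> y) \<and> (\<forall>x. \<sigma> (\<sigma> x) = x)"

definition involutive_anti_automorphism :: "('a::semigroup_mult \<Rightarrow> 'a) \<Rightarrow> bool" where
  "involutive_anti_automorphism \<tau> \<longleftrightarrow>
     (\<forall>x y. \<tau> (x * y) = \<tau> y * \<tau> x) \<and> (\<forall>x. \<tau> (\<tau> x) = x)"

definition central :: "('a::semigroup_mult \<Rightarrow> complex) \<Rightarrow> bool" where
  "central f \<longleftrightarrow> (\<forall>x y. f (x * y) = f (y * x))"

definition pre_dAlembert :: "('a::semigroup_mult \<Rightarrow> complex) \<Rightarrow> bool" where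
  "pre_dAlembert f \<longleftrightarrow>
     (\<forall>a x y. f (a * x * y) + f (a * y * x) =
        2 * f a * f (x * y) + 2 * f x * f (a * y) + 2 * f (a * x) * f y
        - 4 * f a * f x * f y)"

end

theory Submission imports Defs begin

text \<open>
  Write \<open>g = f \<circ> \<sigma>\<close>. Replacing \<open>y\<close> by \<open>\<sigma> y\<close> turns the equation into
  \<open>f (x y) + f (\<psi> y x) = 2 f x g y\<close> with the anti-automorphism \<open>\<psi> = \<tau> \<circ> \<sigma>\<close>. Carrying first
  \<open>z\<close> and then \<open>y\<close> from the right end of \<open>x y z\<close> to its left end, and then both back at once,
  yields the pre-d'Alembert equation with \<open>g\<close> in place of \<open>f\<close> on the factors that do not
  contain \<open>x\<close> (\<open>mixed_pre_dAlembert\<close>). Its left-hand side is symmetric in \<open>y\<close> and \<open>z\<close>, so \<open>g\<close> is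
  central, and hence so is \<open>f = g \<circ> \<sigma>\<close>.

  The remaining claims follow from \<open>f \<circ> \<sigma> = f = f \<circ> \<tau>\<close>; the constant is thus \<open>2\<close>, and the mixed
  equation becomes the pre-d'Alembert equation itself. To see that \<open>g = f\<close>, note that for
  central \<open>f\<close> the sum \<open>f (x y z) + f (x z y)\<close> is invariant under all permutations of its arguments.
  Exchanging \<open>x\<close> with \<open>y\<close> in the mixed equation then gives an alternating relation between \<open>f\<close>,
  \<open>g\<close> and their right translates by \<open>z\<close>. If \<open>f\<close> and \<open>g\<close> were linearly independent, this relation
  would force every translate of \<open>f\<close> into the span of \<open>f\<close> and \<open>g\<close>, say
  \<open>f (x z) = f x A z + g x B z\<close>, and comparing coefficients in it once more would give
  \<open>A (\<sigma> z) + A z = 2 g z\<close>. The left-hand side is invariant under \<open>z \<mapsto> \<sigma> z\<close>, so \<open>g = f\<close> after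
  all (\<open>proportional_comp_automorphism\<close>). If instead \<open>g = c f\<close>, the constant is
  determined by composing the functional equation with \<open>\<sigma>\<close> and with \<open>\<tau>\<close>
  (\<open>comp_anti_automorphism_eq\<close>, \<open>comp_automorphism_eq\<close>).
\<close>

text \<open>
  If \<open>f\<close> and \<open>g\<close> are independent and \<open>f \<and> Q + P \<and> g = 0\<close> in the exterior square, then \<open>P\<close> lies in the
  span of \<open>f\<close> and \<open>g\<close>: evaluating the second argument at two points that witness the
  independence leaves a linear system from which \<open>Q\<close> can be eliminated.
\<close>

lemma in_span_of_alternating_relation:
  fixes f g P Q :: "'a \<Rightarrow> 'b::field"
  assumes indep: "f p * g q \<noteq> f q * g p"
    and alt: "\<And>x y. f x * Q y + P x * g y = f y * Q x + P y * g x"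
  shows "\<exists>a b. \<forall>x. P x = f x * a + g x * b"
proof (intro exI allI)
  fix x
  let ?d = "f p * g q - f q * g p"
  have "P x * ?d = f x * (f q * Q p - f p * Q q) + g x * (f p * P q - f q * P p)"
    using alt[of x p] alt[of x q] by algebra
  moreover have "?d \<noteq> 0" using indep by simp
  ultimately have "P x =
      (f x * (f q * Q p - f p * Q q) + g x * (f p * P q - f q * P p)) / ?d"
    using nonzero_eq_divide_eq by blast
  then show "P x = f x * ((f q * Q p - f p * Q q) / ?d)
      + g x * ((f p * P q - f q * P p) / ?d)"
    by (simp only: add_divide_distrib times_divide_eq_right)
qed

locale dAlembert_variant =
  fixes \<sigma> \<tau> :: "'a::semigroup_mult \<Rightarrow> 'a" and f :: "'a \<Rightarrow> complex"
  assumes \<sigma>: "involutive_automorphism \<sigma>"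
    and \<tau>: "involutive_anti_automorphism \<tau>"
    and nonzero: "\<exists>x. f x \<noteq> 0"
    and equation: "f (x * \<sigma> y) + f (\<tau> y * x) = 2 * f x * f y"
begin

lemma \<sigma>_mult [simp]: "\<sigma> (x * y) = \<sigma> x * \<sigma> y"
  and \<sigma>_\<sigma> [simp]: "\<sigma> (\<sigma> x) = x"
  using \<sigma> by (auto simp: involutive_automorphism_def)

lemma \<tau>_mult [simp]: "\<tau> (x * y) = \<tau> y * \<tau> x"
  and \<tau>_\<tau> [simp]: "\<tau> (\<tau> x) = x"
  using \<tau> by (auto simp: involutive_anti_automorphism_def)

lemma equation_at_\<sigma>: "f (x * y) + f (\<tau> (\<sigma> y) * x) = 2 * f x * f (\<sigma> y)"
  using equation[of x "\<sigma> y"] by simp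

lemma equation_at_\<tau>: "f (x * \<sigma> (\<tau> y)) + f (y * x) = 2 * f x * f (\<tau> y)"
  using equation[of x "\<tau> y"] by simp

text \<open>
  Since \<open>\<psi>\<close> reverses products, \<open>\<psi> y \<psi> z x = \<psi> (z y) x\<close> can be carried back in one step, which
  puts \<open>z y\<close> rather than \<open>y z\<close> behind \<open>x\<close>.
\<close>

lemma mixed_pre_dAlembert:
  "f (x * y * z) + f (x * z * y) =
     2 * f x * f (\<sigma> (z * y)) + 2 * f (x * y) * f (\<sigma> z) + 2 * f (x * z) * f (\<sigma> y)
     - 4 * f x * f (\<sigma> y) * f (\<sigma> z)"
proof -
  let ?\<psi> = "\<lambda>y. \<tau> (\<sigma> y)"
  have "f (x * y * z) + f (?\<psi> z * x * y) = 2 * f (x * y) * f (\<sigma> z)"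
    using equation_at_\<sigma>[of "x * y" z] by (simp add: mult.assoc)
  moreover have "f (?\<psi> z * x * y) + f (?\<psi> y * ?\<psi> z * x) = 2 * f (?\<psi> z * x) * f (\<sigma> y)"
    using equation_at_\<sigma>[of "?\<psi> z * x" y] by (simp add: mult.assoc)
  moreover have "f (x * z) + f (?\<psi> z * x) = 2 * f x * f (\<sigma> z)"
    by (rule equation_at_\<sigma>)
  moreover have "f (x * z * y) + f (?\<psi> y * ?\<psi> z * x) = 2 * f x * f (\<sigma> (z * y))"
    using equation_at_\<sigma>[of x "z * y"] by (simp add: mult.assoc)
  ultimately show ?thesis by algebra
qed

lemma commute: "f (x * y) = f (y * x)"
proof -
  obtain a where "f a \<noteq> 0" using nonzero by blast
  moreover have "f a * f (x * y) = f a * f (y * x)"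
    using mixed_pre_dAlembert[of a "\<sigma> x" "\<sigma> y"] mixed_pre_dAlembert[of a "\<sigma> y" "\<sigma> x"]
    by (simp add: algebra_simps) auto
  ultimately show ?thesis by simp
qed

text \<open>
  The exchange of \<open>x\<close> and \<open>y\<close> in the mixed equation, whose left-hand side is symmetric in all
  three arguments because \<open>f\<close> is central. For fixed \<open>z\<close> it has the shape \<open>f \<and> Q + P \<and> g = 0\<close>.
\<close>

lemma alternating_relation:
  "f x * (f (\<sigma> (y * z)) - 2 * f (\<sigma> y) * f (\<sigma> z)) + f (x * z) * f (\<sigma> y) =
   f y * (f (\<sigma> (x * z)) - 2 * f (\<sigma> x) * f (\<sigma> z)) + f (y * z) * f (\<sigma> x)"
proof -
  have "f (x * y * z) + f (x * z * y) = f (y * x * z) + f (y * z * x)"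
    using commute[of x "y * z"] commute[of "x * z" y] by (simp add: mult.assoc add.commute)
  then have "2 * f x * f (\<sigma> (y * z)) + 2 * f (x * y) * f (\<sigma> z) + 2 * f (x * z) * f (\<sigma> y)
      - 4 * f x * f (\<sigma> y) * f (\<sigma> z) =
    2 * f y * f (\<sigma> (x * z)) + 2 * f (x * y) * f (\<sigma> z) + 2 * f (y * z) * f (\<sigma> x)
      - 4 * f y * f (\<sigma> x) * f (\<sigma> z)"
    unfolding mixed_pre_dAlembert by (simp add: commute)
  then have "2 * (f x * (f (\<sigma> (y * z)) - 2 * f (\<sigma> y) * f (\<sigma> z)) + f (x * z) * f (\<sigma> y)) =
      2 * (f y * (f (\<sigma> (x * z)) - 2 * f (\<sigma> x) * f (\<sigma> z)) + f (y * z) * f (\<sigma> x))"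
    by algebra
  then show ?thesis by (subst (asm) mult_cancel_left) simp
qed

lemma proportional_comp_automorphism: "f x * f (\<sigma> y) = f y * f (\<sigma> x)"
proof (rule ccontr)
  assume indep: "f x * f (\<sigma> y) \<noteq> f y * f (\<sigma> x)"
  have "\<exists>a b. \<forall>u. f (u * z) = f u * a + f (\<sigma> u) * b" for z
    by (rule in_span_of_alternating_relation[where g = "\<lambda>u. f (\<sigma> u)",
          OF indep alternating_relation])
  then obtain A B where translate: "f (u * z) = f u * A z + f (\<sigma> u) * B z" for u z
    by metis
  have translate_\<sigma>: "f (\<sigma> (u * z)) = f (\<sigma> u) * A (\<sigma> z) + f u * B (\<sigma> z)" for u z
    using translate[of "\<sigma> u" "\<sigma> z"] by simp
  have coefficient: "A (\<sigma> z) + A z = 2 * f (\<sigma> z)" for z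
  proof -
    have "(f x * f (\<sigma> y) - f y * f (\<sigma> x)) * (A (\<sigma> z) + A z - 2 * f (\<sigma> z)) = 0"
      using alternating_relation[of x y z] unfolding translate translate_\<sigma> by algebra
    with indep show ?thesis by simp
  qed
  have "f (\<sigma> z) = f z" for z
    using coefficient[of z] coefficient[of "\<sigma> z"] by (simp add: add.commute)
  with indep show False by (simp add: mult.commute)
qed

text \<open>
  Composing the equation with \<open>\<sigma>\<close> shows that \<open>f \<circ> \<sigma>\<close> satisfies it with the last factor \<open>f y\<close>
  replaced by \<open>f (\<tau> y)\<close>. Since \<open>f \<circ> \<sigma>\<close> is proportional to \<open>f\<close>, the two factors must agree.
\<close>

lemma comp_anti_automorphism_eq: "f (\<tau> y) = f y"
proof -
  obtain a where a: "f a \<noteq> 0" using nonzero by blast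
  define c where "c = f (\<sigma> a) / f a"
  have c: "f (\<sigma> x) = c * f x" for x
    using proportional_comp_automorphism[of a x] a by (simp add: c_def field_simps)
  \<comment> \<open>Otherwise \<open>f\<close> would vanish on the range of \<open>\<sigma>\<close>, which is everything.\<close>
  have "c \<noteq> 0" using c[of "\<sigma> a"] a by auto
  have "f (\<sigma> (a * \<sigma> y)) + f (\<sigma> (\<tau> y * a)) = 2 * f (\<sigma> a) * f (\<tau> y)"
    using equation_at_\<tau>[of "\<sigma> a" y] commute[of "\<sigma> a"]
    by (simp add: add.commute)
  then have "c * (f (a * \<sigma> y) + f (\<tau> y * a)) = 2 * (c * f a) * f (\<tau> y)"
    unfolding c by (simp only: distrib_left)
  with a \<open>c \<noteq> 0\<close> show ?thesis by (simp add: equation)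
qed

lemma comp_automorphism_eq: "f (\<sigma> y) = f y"
proof -
  obtain a where a: "f a \<noteq> 0" using nonzero by blast
  have "f (\<tau> (a * \<sigma> y)) + f (\<tau> (\<tau> y * a)) = 2 * f (\<tau> a) * f (\<sigma> y)"
    using equation_at_\<sigma>[of "\<tau> a" y] by (simp add: commute add.commute)
  then show ?thesis
    unfolding comp_anti_automorphism_eq using equation[of a y] a by simp
qed

end

theorem proposition3p3:
  fixes \<sigma> \<tau> :: "'a::semigroup_mult \<Rightarrow> 'a" and f :: "'a \<Rightarrow> complex"
  assumes "involutive_automorphism \<sigma>"
    and "involutive_anti_automorphism \<tau>"
    and "\<exists>x. f x \<noteq> 0"
    and "\<forall>x y. f (x * \<sigma> y) + f (\<tau> y * x) = 2 * f x * f y"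
  shows "central f \<and>
    (\<exists>c::complex. c \<noteq> 0 \<and> (\<forall>x. f (\<sigma> x) + f (\<tau> x) = c * f x)) \<and>
    pre_dAlembert f"
proof -
  interpret dAlembert_variant \<sigma> \<tau> f
    using assms by unfold_locales auto
  have "central f"
    unfolding central_def using commute by blast
  moreover have "\<forall>x. f (\<sigma> x) + f (\<tau> x) = 2 * f x"
    by (simp add: comp_automorphism_eq comp_anti_automorphism_eq)
  then have "\<exists>c::complex. c \<noteq> 0 \<and> (\<forall>x. f (\<sigma> x) + f (\<tau> x) = c * f x)"
    by (intro exI[of _ 2]) simp
  moreover have "pre_dAlembert f"
    unfolding pre_dAlembert_def
  proof (intro allI)
    fix a x y
    show "f (a * x * y) + f (a * y * x) =
        2 * f a * f (x * y) + 2 * f x * f (a * y) + 2 * f (a * x) * f y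
        - 4 * f a * f x * f y"
      using mixed_pre_dAlembert[of a x y] commute[of y x]
      unfolding comp_automorphism_eq by algebra
  qed
  ultimately show ?thesis by blast
qed

end
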